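(* If $F$ is a distribution on $\mathbb{R}$ satisfying $\int_0^\infty(1-F(x))^{1/d}\,dx<\infty$ for which $N>0$, then the inequality $G\le LN$ holds almost surely.
   Context: Fix $d\ge2$. $\{X_{\mathbf{v}}:\mathbf{v}\in\mathbb{Z}^d\}$ are independent real random variables with common distribution (function) $F$. A lattice animal is a finite non-empty connected (nearest-neighbour) set of sites $\xi\subset\mathbb{Z}^d$; $|\xi|$ is its number of sites and $S(\xi)=\sum_{\mathbf{v}\in\xi}X_{\mathbf{v}}$ its weight. $N_n$ is the maximal weight among lattice animals of size $n$ containing the origin. Under the stated integral condition, $n^{-1}N_n$ converges almost surely to a non-random finite constant, denoted $N$ (known result). With $B_n=\{0,\ldots,n-1\}^d$, set $G_n=\max\{S(\xi):\xi\text{ a lattice animal},\ \xi\subseteq B_n\}$ and $L_n=\min\{|\xi|:\xi\text{ a lattice animal},\ \xi\subseteq B_n,\ S(\xi)=G_n\}$. Under the stated integral condition, $n^{-d}G_n$ converges almost surely to a non-random finite constant, denoted $G$. Finally $L=\liminf_{n\to\infty}n^{-d}L_n$, which may a priori be random. *)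

theory Defs
  imports "HOL-Probability.Probability"
begin

text \<open>The lattice \<open>\<int>\<^sup>d\<close> is the type \<open>int ^ 'd\<close>, with \<open>d = CARD('d)\<close>.\<close>

definition adjacent :: "int ^ 'd \<Rightarrow> int ^ 'd \<Rightarrow> bool" where
  "adjacent u v \<longleftrightarrow> (\<Sum>i\<in>UNIV. \<bar>u $ i - v $ i\<bar>) = 1"

definition lattice_animal :: "(int ^ 'd) set \<Rightarrow> bool" where
  "lattice_animal \<xi> \<longleftrightarrow> finite \<xi> \<and> \<xi> \<noteq> {} \<and>
     (\<forall>u\<in>\<xi>. \<forall>v\<in>\<xi>. (u, v) \<in> {(a, b). a \<in> \<xi> \<and> b \<in> \<xi> \<and> adjacent a b}\<^sup>*)"

text \<open>The definitions below take a fixed configuration \<open>x\<close> of site values; the random quantities are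
  obtained with \<open>x = (\<lambda>v. X v \<omega>)\<close>. In \<open>max_weight_origin\<close> (\<open>N\<^sub>n\<close>), \<open>max_weight_box\<close> (\<open>G\<^sub>n\<close>) and
  \<open>min_size_box\<close> (\<open>L\<^sub>n\<close>) the sets are finite and non-empty when \<open>n \<ge> 1\<close>; the value at \<open>n = 0\<close> is
  arbitrary and only ever enters through limits.\<close>

definition weight :: "(int ^ 'd \<Rightarrow> real) \<Rightarrow> (int ^ 'd) set \<Rightarrow> real" where
  "weight x \<xi> = (\<Sum>v\<in>\<xi>. x v)"

definition max_weight_origin :: "(int ^ 'd \<Rightarrow> real) \<Rightarrow> nat \<Rightarrow> real" where
  "max_weight_origin x n = Max {weight x \<xi> | \<xi>. lattice_animal \<xi> \<and> card \<xi> = n \<and> 0 \<in> \<xi>}"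

definition lattice_box :: "nat \<Rightarrow> (int ^ 'd) set" where
  "lattice_box n = {v. \<forall>i. 0 \<le> v $ i \<and> v $ i \<le> int n - 1}"

definition max_weight_box :: "(int ^ 'd \<Rightarrow> real) \<Rightarrow> nat \<Rightarrow> real" where
  "max_weight_box x n = Max {weight x \<xi> | \<xi>. lattice_animal \<xi> \<and> \<xi> \<subseteq> lattice_box n}"

definition min_size_box :: "(int ^ 'd \<Rightarrow> real) \<Rightarrow> nat \<Rightarrow> nat" where
  "min_size_box x n =
     Min {card \<xi> | \<xi>. lattice_animal \<xi> \<and> \<xi> \<subseteq> lattice_box n \<and> weight x \<xi> = max_weight_box x n}"

text \<open>The lower limit is taken in \<open>ereal\<close>; its terms lie in \<open>[0,1]\<close> for \<open>n \<ge> 1\<close>, so it is finite.\<close>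

definition lower_size_density :: "(int ^ 'd \<Rightarrow> real) \<Rightarrow> ereal" where
  "lower_size_density x =
     liminf (\<lambda>n. ereal (real (min_size_box x n) / real n ^ CARD('d)))"

end

theory Submission
  imports Defs
begin

text \<open>
  Fix \<open>c > N\<close> and a large \<open>k\<close>, and call a site \<open>v\<close> exceptional if some lattice animal through \<open>v\<close> with
  at least \<open>k\<close> sites has more than \<open>c\<close> times its size as weight. Almost sure convergence of
  \<open>N\<^sub>n / n\<close> to \<open>N\<close> at the origin makes the probability that a given site is exceptional tend to
  \<open>0\<close> as \<open>k \<rightarrow> \<infinity>\<close>. Consider a lattice animal \<open>\<xi> \<subseteq> B\<^sub>n\<close> with \<open>S(\<xi>) = G\<^sub>n\<close> and \<open>|\<xi>| = L\<^sub>n\<close>. If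
  \<open>L\<^sub>n \<ge> k\<close> and \<open>\<xi>\<close> contains one site that is not exceptional, then \<open>G\<^sub>n \<le> c L\<^sub>n\<close> by definition.
  Otherwise \<open>\<xi>\<close> has fewer than \<open>k\<close> sites or consists of exceptional sites only, so it occupies a
  small proportion \<open>\<delta>\<close> of the box. A set of so few sites cannot carry much weight: splitting values
  at a level \<open>K\<close> bounds its weight by \<open>K \<delta> n\<^sup>d\<close> plus the sum over the box of all values above \<open>K\<close>, which
  is a small multiple of \<open>n\<^sup>d\<close>. If \<open>G > 0\<close> this contradicts \<open>G\<^sub>n \<sim> G n\<^sup>d\<close> for large \<open>n\<close>. Hence
  \<open>G\<^sub>n \<le> c L\<^sub>n\<close> eventually, so \<open>G \<le> c L\<close>, and \<open>c\<close> decreases to \<open>N\<close>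
  (\<open>lower_size_density_ge\<close>, \<open>lower_size_density_mult_ge\<close>). If \<open>G \<le> 0\<close> there is nothing to prove. The
  argument never joins \<open>\<xi>\<close> to the origin, so arbitrarily heavy negative tails are harmless.

  Two spatial averages over \<open>B\<^sub>n\<close> have to be small, almost surely and for all \<open>n\<close> at once: the
  proportion of exceptional sites, which form a stationary but not an independent field, and the
  normalised sum of the values above \<open>K\<close>. Both follow from Wiener's maximal inequality for a
  measure preserving action of \<open>\<int>\<^sup>d\<close> (\<open>maximal_inequality\<close>): for \<open>\<phi> \<ge> 0\<close>, the probability that some
  average of \<open>\<phi>\<close> over a box \<open>B\<^sub>n\<close> reaches \<open>c\<close> is at most \<open>4\<^sup>d / c\<close> times the integral of \<open>\<phi>\<close>. If the
  integrals of \<open>\<phi>\<^sub>k\<close> tend to \<open>0\<close>, then all averages of \<open>\<phi>\<^sub>k\<close> are small for a suitable random \<open>k\<close>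
  (\<open>AE_uniformly_small_averages\<close>). For exceptional sites \<open>\<phi>\<^sub>k\<close> is an indicator; for the large values it
  is \<open>X\<^sub>0\<close> restricted to \<open>X\<^sub>0 > K\<close>, whose integral tends to \<open>0\<close> because the integral
  condition on \<open>F\<close> makes the positive part of \<open>X\<^sub>0\<close> integrable.
\<close>

section \<open>Boxes and cubes\<close>

lemma lattice_box_eq_image: "lattice_box n = vec_lambda ` (UNIV \<rightarrow>\<^sub>E {0..int n - 1})"
proof (intro set_eqI iffI)
  fix v :: "int ^ 'd" assume "v \<in> lattice_box n"
  then have "v = vec_lambda (\<lambda>i. v $ i)" "(\<lambda>i. v $ i) \<in> UNIV \<rightarrow>\<^sub>E {0..int n - 1}"
    by (auto simp: lattice_box_def)
  then show "v \<in> vec_lambda ` (UNIV \<rightarrow>\<^sub>E {0..int n - 1})" by blast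
qed (auto simp: lattice_box_def PiE_iff)

lemma finite_lattice_box [simp]: "finite (lattice_box n)"
  by (simp add: lattice_box_eq_image finite_PiE)

lemma card_lattice_box [simp]: "card (lattice_box n :: (int ^ 'd) set) = n ^ CARD('d)"
proof -
  have "inj_on vec_lambda (UNIV \<rightarrow>\<^sub>E {0..int n - 1} :: ('d \<Rightarrow> int) set)"
    by (auto simp: inj_on_def vec_lambda_inject)
  then show ?thesis
    by (simp add: lattice_box_eq_image card_image card_PiE)
qed

lemma zero_in_lattice_box: "n \<ge> 1 \<Longrightarrow> 0 \<in> lattice_box n"
  by (simp add: lattice_box_def)

definition cube :: "int ^ 'd \<Rightarrow> nat \<Rightarrow> (int ^ 'd) set" where
  "cube u n = (+) u ` lattice_box n"

lemma mem_cube_iff: "w \<in> cube u n \<longleftrightarrow> (\<forall>i. u $ i \<le> w $ i \<and> w $ i < u $ i + int n)"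
proof -
  have "w \<in> cube u n \<longleftrightarrow> w - u \<in> lattice_box n"
    by (force simp: cube_def image_iff)
  moreover have "0 \<le> a - b \<and> a - b \<le> int n - 1 \<longleftrightarrow> b \<le> a \<and> a < b + int n" for a b
    by linarith
  ultimately show ?thesis by (simp add: lattice_box_def)
qed

lemma finite_cube [simp]: "finite (cube u n)"
  by (simp add: cube_def)

lemma card_cube [simp]: "card (cube (u :: int ^ 'd) n) = n ^ CARD('d)"
  by (simp add: cube_def card_image)

text \<open>The cube of corners \<open>u\<close> found here has \<open>(2 n)\<^sup>d\<close> sites, which is the source of the constant \<open>2\<^sup>d\<close> in
  the covering lemma.\<close>

lemma corners_of_meeting_cubes:
  fixes u v :: "int ^ 'd"
  assumes "cube u m \<inter> cube v n \<noteq> {}" "m \<le> n"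
  shows "u \<in> cube (\<chi> i. v $ i - int n) (2 * n)"
proof -
  obtain w where w: "w \<in> cube u m" "w \<in> cube v n" using assms by auto
  have "v $ i - int n \<le> u $ i \<and> u $ i < v $ i - int n + int (2 * n)" for i
  proof -
    have "u $ i \<le> w $ i" "w $ i < u $ i + int m" "v $ i \<le> w $ i" "w $ i < v $ i + int n"
      using w by (auto simp: mem_cube_iff)
    moreover have "int m \<le> int n" "int (2 * n) = 2 * int n" using assms(2) by auto
    ultimately show ?thesis by linarith
  qed
  then show ?thesis by (simp add: mem_cube_iff)
qed

section \<open>A Vitali covering lemma\<close>

text \<open>Greedy selection: take a cube of maximal side, discard the corners of all cubes that meet it, and
  repeat. By \<open>corners_of_meeting_cubes\<close> each selected cube of side \<open>r u\<close> is responsible for at most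
  \<open>2\<^sup>d (r u)\<^sup>d\<close> corners.\<close>

lemma vitali_cubes:
  fixes S :: "(int ^ 'd) set"
  assumes "finite S" "\<And>u. u \<in> S \<Longrightarrow> 1 \<le> r u"
  shows "\<exists>T\<subseteq>S. (\<forall>u\<in>T. \<forall>v\<in>T. u \<noteq> v \<longrightarrow> cube u (r u) \<inter> cube v (r v) = {}) \<and>
           card S \<le> 2 ^ CARD('d) * (\<Sum>u\<in>T. r u ^ CARD('d))"
  using assms
proof (induction "card S" arbitrary: S rule: less_induct)
  case less
  show ?case
  proof (cases "S = {}")
    case False
    then have "Max (r ` S) \<in> r ` S"
      using less.prems(1) by (intro Max_in) auto
    then obtain u0 where u0: "u0 \<in> S" "Max (r ` S) = r u0" by auto
    then have max: "r u \<le> r u0" if "u \<in> S" for u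
      using Max_ge[of "r ` S" "r u"] less.prems(1) that by simp
    define S' where "S' = {u \<in> S. cube u (r u) \<inter> cube u0 (r u0) = {}}"
    have "u0 \<in> cube u0 (r u0)"
      using less.prems(2)[OF u0(1)] by (auto simp: mem_cube_iff)
    then have S': "S' \<subseteq> S" "u0 \<notin> S'" "finite S'"
      using less.prems(1) by (auto simp: S'_def)
    have "card S' < card S"
      using S' u0 less.prems(1) by (metis psubsetI psubset_card_mono)
    with less.hyps[of S'] S' less.prems obtain T where
      T: "T \<subseteq> S'" "\<And>u v. u \<in> T \<Longrightarrow> v \<in> T \<Longrightarrow> u \<noteq> v \<Longrightarrow> cube u (r u) \<inter> cube v (r v) = {}"
        "card S' \<le> 2 ^ CARD('d) * (\<Sum>u\<in>T. r u ^ CARD('d))"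
      by (metis subset_iff)
    have "S - S' \<subseteq> cube (\<chi> i. u0 $ i - int (r u0)) (2 * r u0)"
      using corners_of_meeting_cubes max by (fastforce simp: S'_def)
    then have "card (S - S') \<le> (2 * r u0) ^ CARD('d)"
      by (metis card_cube card_mono finite_cube)
    moreover have "card S = card S' + card (S - S')"
      using S' less.prems(1) by (metis card_Diff_subset card_mono le_add_diff_inverse)
    moreover have "finite T" "u0 \<notin> T"
      using T(1) S' by (auto intro: finite_subset)
    ultimately have "card S \<le> 2 ^ CARD('d) * (\<Sum>u\<in>insert u0 T. r u ^ CARD('d))"
      using T(3) by (simp add: algebra_simps)
    moreover have "insert u0 T \<subseteq> S" using T(1) S'(1) u0(1) by auto
    moreover have "\<forall>u\<in>insert u0 T. \<forall>v\<in>insert u0 T. u \<noteq> v \<longrightarrow> cube u (r u) \<inter> cube v (r v) = {}"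
      using T(1,2) by (auto simp: S'_def)
    ultimately show ?thesis by blast
  qed auto
qed

text \<open>The selected cubes are disjoint, so the mass that \<open>g\<close> gives to them adds up to at most its mass on
  \<open>W\<close>. This is the weak type inequality for the counting measure on the lattice.\<close>

lemma card_heavy_corners_le:
  fixes g :: "int ^ 'd \<Rightarrow> ennreal"
  assumes "finite S" "finite W" "\<And>u. u \<in> S \<Longrightarrow> 1 \<le> r u" "\<And>u. u \<in> S \<Longrightarrow> cube u (r u) \<subseteq> W"
    and heavy: "\<And>u. u \<in> S \<Longrightarrow> c * of_nat (r u ^ CARD('d)) \<le> (\<Sum>w\<in>cube u (r u). g w)"
  shows "c * of_nat (card S) \<le> 2 ^ CARD('d) * (\<Sum>w\<in>W. g w)"
proof -
  obtain T where T: "T \<subseteq> S"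
      "\<forall>u\<in>T. \<forall>v\<in>T. u \<noteq> v \<longrightarrow> cube u (r u) \<inter> cube v (r v) = {}"
      "card S \<le> 2 ^ CARD('d) * (\<Sum>u\<in>T. r u ^ CARD('d))"
    using vitali_cubes[of S r] assms(1,3) by metis
  have "finite T" using T(1) assms(1) finite_subset by blast
  define R where "R = (\<Sum>u\<in>T. r u ^ CARD('d))"
  have "c * of_nat (card S) \<le> c * of_nat (2 ^ CARD('d) * R)"
    using T(3) unfolding R_def by (intro mult_left_mono of_nat_mono) simp_all
  also have "\<dots> = 2 ^ CARD('d) * (c * of_nat R)"
    by (simp add: mult.left_commute)
  also have "c * of_nat R = (\<Sum>u\<in>T. c * of_nat (r u ^ CARD('d)))"
    unfolding R_def of_nat_sum by (rule sum_distrib_left)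
  also have "2 ^ CARD('d) * \<dots> \<le> 2 ^ CARD('d) * (\<Sum>w\<in>W. g w)"
  proof (rule mult_left_mono)
    have "(\<Sum>u\<in>T. c * of_nat (r u ^ CARD('d))) \<le> (\<Sum>u\<in>T. \<Sum>w\<in>cube u (r u). g w)"
      using T(1) heavy by (intro sum_mono) blast
    also have "\<dots> = (\<Sum>w\<in>(\<Union>u\<in>T. cube u (r u)). g w)"
      using T(2) \<open>finite T\<close> by (intro sum.UNION_disjoint[symmetric]) auto
    also have "\<dots> \<le> (\<Sum>w\<in>W. g w)"
      using T(1) assms(2,4) by (intro sum_mono2) auto
    finally show "(\<Sum>u\<in>T. c * of_nat (r u ^ CARD('d))) \<le> (\<Sum>w\<in>W. g w)" .
  qed simp
  finally show ?thesis .
qed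

section \<open>A maximal inequality for lattice actions\<close>

locale measure_preserving_lattice_action =
  fixes M :: "'a measure" and T :: "int ^ 'd \<Rightarrow> 'a \<Rightarrow> 'a"
  assumes T_measurable [measurable]: "\<And>v. T v \<in> M \<rightarrow>\<^sub>M M"
    and distr_T: "\<And>v. distr M M (T v) = M"
    and T_T: "\<And>u v x. x \<in> space M \<Longrightarrow> T v (T u x) = T (u + v) x"
begin

lemma nn_integral_T:
  assumes [measurable]: "\<phi> \<in> borel_measurable M"
  shows "(\<integral>\<^sup>+x. \<phi> (T v x) \<partial>M) = (\<integral>\<^sup>+x. \<phi> x \<partial>M)"
proof -
  have "(\<integral>\<^sup>+x. \<phi> (T v x) \<partial>M) = (\<integral>\<^sup>+x. \<phi> x \<partial>distr M M (T v))"
    by (simp add: nn_integral_distr)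
  then show ?thesis by (simp only: distr_T)
qed

text \<open>Transference from the lattice to \<open>M\<close>: \<open>card_heavy_corners_le\<close> is applied to \<open>w \<mapsto> \<phi> (T w x)\<close> on a
  window of corners of side \<open>m\<close>, and then integrated. Cubes of side at most \<open>m\<close> with a corner in the
  window stay inside the window of side \<open>2 m\<close>, which costs a second factor \<open>2\<^sup>d\<close>. Letting the side of the
  window of corners tend to infinity would give \<open>2\<^sup>d\<close> in place of \<open>4\<^sup>d\<close>; any constant serves here.\<close>

lemma maximal_inequality_bounded_scale:
  fixes \<phi> :: "'a \<Rightarrow> ennreal" and c :: ennreal
  assumes \<phi> [measurable]: "\<phi> \<in> borel_measurable M"
  shows "c * emeasure M {x \<in> space M. \<exists>n\<in>{1..m}.
            c * of_nat (n ^ CARD('d)) \<le> (\<Sum>v\<in>lattice_box n. \<phi> (T v x))}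
         \<le> 4 ^ CARD('d) * (\<integral>\<^sup>+x. \<phi> x \<partial>M)"
proof (cases "m = 0")
  case False
  define A where "A = {x \<in> space M. \<exists>n\<in>{1..m}.
    c * of_nat (n ^ CARD('d)) \<le> (\<Sum>v\<in>lattice_box n. \<phi> (T v x))}"
  have A [measurable]: "A \<in> sets M" unfolding A_def by measurable
  have four: "(4 :: ennreal) ^ CARD('d) = 2 ^ CARD('d) * 2 ^ CARD('d)"
    by (simp flip: power_mult_distrib)
  define D where "D = (of_nat (m ^ CARD('d)) :: ennreal)"
  have pointwise: "c * (\<Sum>u\<in>lattice_box m. indicator A (T u x))
      \<le> 2 ^ CARD('d) * (\<Sum>w\<in>lattice_box (2 * m). \<phi> (T w x))" if x: "x \<in> space M" for x
  proof -
    define S where "S = {u \<in> lattice_box m. T u x \<in> A}"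
    have "\<forall>u\<in>S. \<exists>n\<in>{1..m}. c * of_nat (n ^ CARD('d)) \<le> (\<Sum>v\<in>lattice_box n. \<phi> (T v (T u x)))"
      by (auto simp: S_def A_def)
    then obtain r where r: "\<And>u. u \<in> S \<Longrightarrow> r u \<in> {1..m}"
      "\<And>u. u \<in> S \<Longrightarrow> c * of_nat (r u ^ CARD('d)) \<le> (\<Sum>v\<in>lattice_box (r u). \<phi> (T v (T u x)))"
      by metis
    have shift: "(\<Sum>v\<in>lattice_box (r u). \<phi> (T v (T u x))) = (\<Sum>w\<in>cube u (r u). \<phi> (T w x))" for u
      by (simp add: cube_def sum.reindex T_T[OF x])
    have sub: "cube u (r u) \<subseteq> lattice_box (2 * m)" if "u \<in> S" for u
    proof
      fix w assume w: "w \<in> cube u (r u)"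
      have "0 \<le> w $ i \<and> w $ i \<le> int (2 * m) - 1" for i
      proof -
        have "u $ i \<le> w $ i" "w $ i < u $ i + int (r u)" using w by (auto simp: mem_cube_iff)
        moreover have "0 \<le> u $ i" "u $ i \<le> int m - 1"
          using that by (auto simp: S_def lattice_box_def)
        moreover have "int (r u) \<le> int m" using r(1)[OF that] by simp
        ultimately show ?thesis by simp
      qed
      then show "w \<in> lattice_box (2 * m)" by (simp add: lattice_box_def)
    qed
    have "c * of_nat (card S) \<le> 2 ^ CARD('d) * (\<Sum>w\<in>lattice_box (2 * m). \<phi> (T w x))"
      using r shift sub by (intro card_heavy_corners_le[where r = r]) (auto simp: S_def)
    moreover have "of_nat (card S) = (\<Sum>u\<in>lattice_box m. indicator A (T u x) :: ennreal)"
      by (simp add: S_def indicator_def sum.If_cases Int_def)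
    ultimately show ?thesis by simp
  qed
  have "c * (D * emeasure M A) = (\<integral>\<^sup>+x. c * (\<Sum>u\<in>lattice_box m. indicator A (T u x)) \<partial>M)"
    by (subst nn_integral_cmult, simp, subst nn_integral_sum)
      (simp_all add: nn_integral_T D_def)
  also have "\<dots> \<le> (\<integral>\<^sup>+x. 2 ^ CARD('d) * (\<Sum>w\<in>lattice_box (2 * m). \<phi> (T w x)) \<partial>M)"
    by (intro nn_integral_mono pointwise)
  also have "\<dots> = 2 ^ CARD('d) * (of_nat ((2 * m) ^ CARD('d)) * (\<integral>\<^sup>+x. \<phi> x \<partial>M))"
    by (subst nn_integral_cmult, simp, subst nn_integral_sum) (simp_all add: nn_integral_T)
  also have "\<dots> = D * (4 ^ CARD('d) * (\<integral>\<^sup>+x. \<phi> x \<partial>M))"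
    by (simp add: D_def four power_mult_distrib mult_ac)
  finally have "D * (c * emeasure M A) \<le> D * (4 ^ CARD('d) * (\<integral>\<^sup>+x. \<phi> x \<partial>M))"
    by (simp add: mult_ac)
  moreover have "D \<noteq> 0" "D \<noteq> \<top>" using False by (auto simp: D_def ennreal_of_nat_eq_real_of_nat)
  ultimately show ?thesis
    unfolding A_def[symmetric] by (simp add: ennreal_mult_le_mult_iff)
qed simp

lemma maximal_inequality:
  fixes \<phi> :: "'a \<Rightarrow> ennreal" and c :: ennreal
  assumes \<phi> [measurable]: "\<phi> \<in> borel_measurable M"
  shows "c * emeasure M {x \<in> space M. \<exists>n\<ge>1.
            c * of_nat (n ^ CARD('d)) \<le> (\<Sum>v\<in>lattice_box n. \<phi> (T v x))}
         \<le> 4 ^ CARD('d) * (\<integral>\<^sup>+x. \<phi> x \<partial>M)"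
proof -
  define A where "A m = {x \<in> space M. \<exists>n\<in>{1..m}.
    c * of_nat (n ^ CARD('d)) \<le> (\<Sum>v\<in>lattice_box n. \<phi> (T v x))}" for m :: nat
  have "A m \<in> sets M" for m unfolding A_def by measurable
  moreover have "incseq A" by (force simp: incseq_def A_def)
  ultimately have "emeasure M (\<Union>m. A m) = (SUP m. emeasure M (A m))"
    by (subst SUP_emeasure_incseq) auto
  moreover have "(\<Union>m. A m) = {x \<in> space M. \<exists>n\<ge>1.
            c * of_nat (n ^ CARD('d)) \<le> (\<Sum>v\<in>lattice_box n. \<phi> (T v x))}"
    by (force simp: A_def)
  ultimately show ?thesis
    using maximal_inequality_bounded_scale[OF \<phi>, of c]
    by (simp add: A_def SUP_mult_left_ennreal SUP_le_iff)
qed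

text \<open>For fixed \<open>c\<close>, the event that the averages fail to be small for every \<open>k\<close> is contained in the
  exceptional event of each single \<open>k\<close>, whose probability tends to \<open>0\<close> by the maximal inequality.\<close>

lemma AE_uniformly_small_averages:
  fixes \<phi> :: "nat \<Rightarrow> 'a \<Rightarrow> ennreal"
  assumes [measurable]: "\<And>k. \<phi> k \<in> borel_measurable M"
    and lim: "(\<lambda>k. \<integral>\<^sup>+x. \<phi> k x \<partial>M) \<longlonglongrightarrow> 0"
  shows "AE x in M. \<forall>c>0. \<exists>k. \<forall>n\<ge>1.
           (\<Sum>v\<in>lattice_box n. \<phi> k (T v x)) \<le> ennreal (c * real n ^ CARD('d))"
proof -
  define A where "A c k = {x \<in> space M. \<exists>n\<ge>1.
    ennreal c * of_nat (n ^ CARD('d)) \<le> (\<Sum>v\<in>lattice_box n. \<phi> k (T v x))}" for c k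
  have [measurable]: "A c k \<in> sets M" for c k unfolding A_def by measurable
  have null: "emeasure M (\<Inter>k. A c k) = 0" if "c > 0" for c
  proof -
    have "ennreal c * emeasure M (\<Inter>k. A c k) \<le> 4 ^ CARD('d) * (\<integral>\<^sup>+x. \<phi> k x \<partial>M)" for k
    proof -
      have "ennreal c * emeasure M (\<Inter>k. A c k) \<le> ennreal c * emeasure M (A c k)"
        by (intro mult_left_mono emeasure_mono) auto
      also have "\<dots> \<le> 4 ^ CARD('d) * (\<integral>\<^sup>+x. \<phi> k x \<partial>M)"
        unfolding A_def by (rule maximal_inequality) simp
      finally show ?thesis .
    qed
    moreover have "(\<lambda>k. 4 ^ CARD('d) * (\<integral>\<^sup>+x. \<phi> k x \<partial>M)) \<longlonglongrightarrow> 4 ^ CARD('d) * 0"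
      using lim by (intro ennreal_tendsto_cmult) (simp_all add: ennreal_power flip: ennreal_numeral)
    ultimately have "ennreal c * emeasure M (\<Inter>k. A c k) \<le> 0"
      by (intro LIMSEQ_le_const[where x = 0]) auto
    then show ?thesis using that by simp
  qed
  (* Countably many levels c = 1 / (j + 1) suffice to cover every c > 0. *)
  have "AE x in M. \<forall>j. \<exists>k. x \<notin> A (1 / real (Suc j)) k"
    unfolding AE_all_countable
  proof
    fix j
    have "(\<Inter>k. A (1 / real (Suc j)) k) \<in> null_sets M"
      using null[of "1 / real (Suc j)"] by (auto simp: null_sets_def)
    from AE_not_in[OF this] show "AE x in M. \<exists>k. x \<notin> A (1 / real (Suc j)) k" by simp
  qed
  then show ?thesis
  proof (rule AE_mp, intro AE_I2 impI allI)
    fix x and c :: real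
    assume x: "x \<in> space M" "\<forall>j. \<exists>k. x \<notin> A (1 / real (Suc j)) k" and "c > 0"
    obtain j where j: "1 / real (Suc j) < c" using nat_approx_posE[OF \<open>c > 0\<close>] by blast
    from x obtain k where k: "x \<notin> A (1 / real (Suc j)) k" by blast
    show "\<exists>k. \<forall>n\<ge>1. (\<Sum>v\<in>lattice_box n. \<phi> k (T v x)) \<le> ennreal (c * real n ^ CARD('d))"
    proof (intro exI allI impI)
      fix n :: nat assume "n \<ge> 1"
      then have "\<not> ennreal (1 / real (Suc j)) * of_nat (n ^ CARD('d))
          \<le> (\<Sum>v\<in>lattice_box n. \<phi> k (T v x))"
        using k x(1) unfolding A_def by blast
      then have "(\<Sum>v\<in>lattice_box n. \<phi> k (T v x))
          \<le> ennreal (1 / real (Suc j)) * of_nat (n ^ CARD('d))"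
        by (simp only: not_le less_imp_le)
      also have "\<dots> = ennreal (1 / real (Suc j) * real n ^ CARD('d))"
        by (simp add: ennreal_of_nat_eq_real_of_nat ennreal_power flip: ennreal_mult)
      also have "\<dots> \<le> ennreal (c * real n ^ CARD('d))"
        using j by (intro ennreal_leI mult_right_mono) auto
      finally show "(\<Sum>v\<in>lattice_box n. \<phi> k (T v x)) \<le> ennreal (c * real n ^ CARD('d))" .
    qed
  qed
qed

end

section \<open>Lattice animals\<close>

lemma lattice_animal_translate:
  assumes "lattice_animal \<xi>"
  shows "lattice_animal ((+) a ` \<xi>)"
proof -
  let ?R = "\<lambda>\<zeta>. {(u, v). u \<in> \<zeta> \<and> v \<in> \<zeta> \<and> adjacent u v}"
  have "(a + u, a + v) \<in> (?R ((+) a ` \<xi>))\<^sup>*" if "(u, v) \<in> (?R \<xi>)\<^sup>*" for u v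
    using that
  proof (induction rule: rtrancl_induct)
    case (step v w)
    then have "(a + v, a + w) \<in> ?R ((+) a ` \<xi>)" by (simp add: adjacent_def)
    with step.IH show ?case by (rule rtrancl_into_rtrancl)
  qed simp
  with assms show ?thesis by (auto simp: lattice_animal_def)
qed

text \<open>A discrete intermediate value theorem: a nearest-neighbour step changes each coordinate by at most
  one. It bounds the extent of an animal by its size without any recourse to simple paths.\<close>

lemma lattice_animal_intermediate_coordinate:
  assumes "lattice_animal \<xi>" "u \<in> \<xi>" "v \<in> \<xi>" "u $ i \<le> j" "j \<le> v $ i"
  shows "\<exists>w\<in>\<xi>. w $ i = j"
proof -
  have "(u, v) \<in> {(a, b). a \<in> \<xi> \<and> b \<in> \<xi> \<and> adjacent a b}\<^sup>*"
    using assms(1-3) by (simp add: lattice_animal_def)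
  then show ?thesis using assms(5)
  proof (induction rule: rtrancl_induct)
    case base
    then show ?case using assms(2,4) by force
  next
    case (step v w)
    have "\<bar>v $ i - w $ i\<bar> \<le> (\<Sum>i\<in>UNIV. \<bar>v $ i - w $ i\<bar>)"
      by (rule member_le_sum) auto
    then have "\<bar>v $ i - w $ i\<bar> \<le> 1" using step.hyps by (simp add: adjacent_def)
    then have "j \<le> v $ i \<or> j = w $ i" using step.prems by linarith
    then show ?case using step.IH step.hyps by auto
  qed
qed

lemma lattice_animal_extent:
  assumes "lattice_animal \<xi>" "u \<in> \<xi>" "v \<in> \<xi>"
  shows "v $ i - u $ i < int (card \<xi>)"
proof -
  have "{u $ i..v $ i} \<subseteq> (\<lambda>w. w $ i) ` \<xi>"
    using lattice_animal_intermediate_coordinate[OF assms] by force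
  then have "card {u $ i..v $ i} \<le> card \<xi>"
    using assms(1) unfolding lattice_animal_def by (metis surj_card_le)
  moreover have "card {u $ i..v $ i} = nat (v $ i - u $ i + 1)" by simp
  ultimately show ?thesis by linarith
qed

text \<open>Finiteness is what makes the maximum in \<open>max_weight_origin\<close> a genuine upper bound.\<close>

lemma finite_lattice_animals_containing:
  "finite {\<xi>. lattice_animal \<xi> \<and> card \<xi> = n \<and> v \<in> \<xi>}"
proof (rule finite_subset)
  show "{\<xi>. lattice_animal \<xi> \<and> card \<xi> = n \<and> v \<in> \<xi>}
      \<subseteq> Pow (cube (\<chi> i. v $ i - int n) (2 * n))"
  proof clarify
    fix \<xi> w assume "lattice_animal \<xi>" "v \<in> \<xi>" "w \<in> \<xi>" "n = card \<xi>"
    then have "w $ i - v $ i < int n" "v $ i - w $ i < int n" for i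
      using lattice_animal_extent by blast+
    then show "w \<in> cube (\<chi> i. v $ i - int (card \<xi>)) (2 * card \<xi>)"
      unfolding mem_cube_iff \<open>n = card \<xi>\<close> by (simp add: algebra_simps less_imp_le)
  qed
qed simp

lemma weight_le_max_weight_origin:
  assumes "lattice_animal \<xi>" "0 \<in> \<xi>"
  shows "weight x \<xi> \<le> max_weight_origin x (card \<xi>)"
  unfolding max_weight_origin_def
proof (rule Max_ge)
  have "{weight x \<zeta> |\<zeta>. lattice_animal \<zeta> \<and> card \<zeta> = card \<xi> \<and> 0 \<in> \<zeta>}
      = weight x ` {\<zeta>. lattice_animal \<zeta> \<and> card \<zeta> = card \<xi> \<and> 0 \<in> \<zeta>}" by auto
  then show "finite {weight x \<zeta> |\<zeta>. lattice_animal \<zeta> \<and> card \<zeta> = card \<xi> \<and> 0 \<in> \<zeta>}"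
    by (simp add: finite_lattice_animals_containing)
qed (use assms in auto)

lemma obtain_optimal_animal:
  fixes x :: "int ^ 'd \<Rightarrow> real"
  assumes "n \<ge> 1"
  obtains \<xi> where "lattice_animal \<xi>" "\<xi> \<subseteq> lattice_box n"
    "weight x \<xi> = max_weight_box x n" "card \<xi> = min_size_box x n"
proof -
  define \<A> where "\<A> = {\<xi> :: (int ^ 'd) set. lattice_animal \<xi> \<and> \<xi> \<subseteq> lattice_box n}"
  have "finite \<A>"
    by (rule finite_subset[of _ "Pow (lattice_box n)"]) (auto simp: \<A>_def)
  have "{0} \<in> \<A>"
    using zero_in_lattice_box[OF assms] by (simp add: \<A>_def lattice_animal_def)
  have "max_weight_box x n = Max (weight x ` \<A>)"
    unfolding max_weight_box_def \<A>_def by (rule arg_cong[where f = Max]) auto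
  moreover have "Max (weight x ` \<A>) \<in> weight x ` \<A>"
    using \<open>finite \<A>\<close> \<open>{0} \<in> \<A>\<close> by (intro Max_in) auto
  ultimately obtain \<xi> where \<xi>: "\<xi> \<in> \<A>" "weight x \<xi> = max_weight_box x n" by auto
  define \<B> where "\<B> = {\<xi> \<in> \<A>. weight x \<xi> = max_weight_box x n}"
  have "min_size_box x n = Min (card ` \<B>)"
    unfolding min_size_box_def \<B>_def \<A>_def by (rule arg_cong[where f = Min]) auto
  moreover have "Min (card ` \<B>) \<in> card ` \<B>"
    using \<open>finite \<A>\<close> \<xi> by (intro Min_in) (auto simp: \<B>_def)
  ultimately obtain \<zeta> where "\<zeta> \<in> \<B>" "card \<zeta> = min_size_box x n" by auto
  then show ?thesis by (intro that[of \<zeta>]) (auto simp: \<A>_def \<B>_def)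
qed

section \<open>Exceptional sites\<close>

definition translate :: "int ^ 'd \<Rightarrow> (int ^ 'd \<Rightarrow> real) \<Rightarrow> int ^ 'd \<Rightarrow> real" where
  "translate v x = (\<lambda>u. x (v + u))"

text \<open>The configurations in which the origin is exceptional, in the sense of the introduction. A site \<open>v\<close>
  is exceptional for \<open>x\<close> if \<open>translate v x\<close> lies in this set. Phrasing this with single animals, and not
  with their maximal weight, makes it visibly a countable union of measurable conditions.\<close>

definition overweight :: "real \<Rightarrow> nat \<Rightarrow> (int ^ 'd \<Rightarrow> real) set" where
  "overweight c k =
     {x. \<exists>\<xi>. lattice_animal \<xi> \<and> 0 \<in> \<xi> \<and> k \<le> card \<xi> \<and> c * real (card \<xi>) < weight x \<xi>}"

lemma overweight_antimono: "k \<le> l \<Longrightarrow> overweight c l \<subseteq> overweight c k"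
  unfolding overweight_def by (fastforce intro: order_trans)

lemma translate_in_overweight:
  assumes "lattice_animal \<xi>" "v \<in> \<xi>" "k \<le> card \<xi>" "c * real (card \<xi>) < weight x \<xi>"
  shows "translate v x \<in> overweight c k"
proof -
  let ?\<zeta> = "(+) (- v) ` \<xi>"
  have "weight (translate v x) ?\<zeta> = weight x \<xi>"
    by (simp add: weight_def translate_def sum.reindex)
  moreover have "card ?\<zeta> = card \<xi>" by (simp add: card_image)
  moreover have "0 \<in> ?\<zeta>" using assms(2) by force
  ultimately show ?thesis
    using lattice_animal_translate[OF assms(1), of "- v"] assms(3,4)
    unfolding overweight_def by (intro CollectI exI[of _ ?\<zeta>]) simp
qed

lemma eventually_not_overweight:
  assumes "(\<lambda>n. max_weight_origin x n / real n) \<longlonglongrightarrow> N" "N < c"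
  shows "\<exists>k. x \<notin> overweight c k"
proof -
  obtain k where k: "\<And>n. n \<ge> k \<Longrightarrow> max_weight_origin x n / real n < c"
    using order_tendstoD(2)[OF assms] by (auto simp: eventually_sequentially)
  have "x \<notin> overweight c k"
  proof
    assume "x \<in> overweight c k"
    then obtain \<xi> where \<xi>: "lattice_animal \<xi>" "0 \<in> \<xi>" "k \<le> card \<xi>"
      "c * real (card \<xi>) < weight x \<xi>" by (auto simp: overweight_def)
    have "card \<xi> > 0" using \<xi>(1) by (simp add: lattice_animal_def card_gt_0_iff)
    then have "max_weight_origin x (card \<xi>) < c * real (card \<xi>)"
      using k[OF \<xi>(3)] by (simp add: divide_less_eq)
    with weight_le_max_weight_origin[OF \<xi>(1,2), of x] \<xi>(4) show False by simp
  qed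
  then show ?thesis ..
qed

section \<open>The deterministic comparison\<close>

lemma weight_le_truncated:
  fixes x :: "int ^ 'd \<Rightarrow> real" and K :: real
  assumes "finite B" "\<xi> \<subseteq> B" "0 \<le> K"
  shows "weight x \<xi> \<le> K * real (card \<xi>) + (\<Sum>v\<in>B. if K < x v then x v else 0)"
proof -
  have "weight x \<xi> \<le> (\<Sum>v\<in>\<xi>. K + (if K < x v then x v else 0))"
    unfolding weight_def using assms(3) by (intro sum_mono) auto
  also have "\<dots> = K * real (card \<xi>) + (\<Sum>v\<in>\<xi>. if K < x v then x v else 0)"
    by (simp add: sum.distrib)
  also have "(\<Sum>v\<in>\<xi>. if K < x v then x v else 0) \<le> (\<Sum>v\<in>B. if K < x v then x v else 0)"
    using assms by (intro sum_mono2) auto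
  finally show ?thesis by simp
qed

text \<open>The comparison for a single configuration. If an optimal animal violated \<open>G\<^sub>n \<le> c L\<^sub>n\<close>, then it would
  be short or made of exceptional sites, hence would have at most \<open>\<delta> n\<^sup>d\<close> sites and weight at most
  \<open>G n\<^sup>d / 2\<close>, which is impossible for large \<open>n\<close>. This even holds for all large \<open>n\<close>, so it passes to the
  lower limit.\<close>

lemma lower_size_density_ge:
  fixes x :: "int ^ 'd \<Rightarrow> real"
  assumes "c > 0" "G > 0"
    and G: "(\<lambda>n. max_weight_box x n / real n ^ CARD('d)) \<longlonglongrightarrow> G"
    and sparse: "\<And>\<delta>. \<delta> > 0 \<Longrightarrow> \<exists>k. \<forall>n\<ge>1.
      real (card {v \<in> lattice_box n. translate v x \<in> overweight c k}) \<le> \<delta> * real n ^ CARD('d)"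
    and tails: "\<And>\<delta>. \<delta> > 0 \<Longrightarrow> \<exists>K. \<forall>n\<ge>1.
      (\<Sum>v\<in>lattice_box n. if real K < x v then x v else 0) \<le> \<delta> * real n ^ CARD('d)"
  shows "ereal (G / c) \<le> lower_size_density x"
proof -
  obtain K :: nat where K: "\<And>n. n \<ge> 1 \<Longrightarrow>
      (\<Sum>v\<in>lattice_box n. if real K < x v then x v else 0) \<le> G / 4 * real n ^ CARD('d)"
    using tails[of "G / 4"] \<open>G > 0\<close> by auto
  (* With this density the values up to K contribute at most G / 4 per site of the box,
     as do the values above K; together they stay below the limit G. *)
  define \<delta> where "\<delta> = G / (4 * (real K + 1))"
  have "\<delta> > 0" using \<open>G > 0\<close> by (simp add: \<delta>_def)
  then obtain k where k: "\<And>n. n \<ge> 1 \<Longrightarrow>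
      real (card {v \<in> lattice_box n. translate v x \<in> overweight c k}) \<le> \<delta> * real n ^ CARD('d)"
    using sparse by blast
  have "\<forall>\<^sub>F n in sequentially. real k / \<delta> \<le> real n"
    using filterlim_real_sequentially by (auto simp: filterlim_at_top)
  moreover have "\<forall>\<^sub>F n in sequentially. G / 2 < max_weight_box x n / real n ^ CARD('d)"
    using G \<open>G > 0\<close> by (intro order_tendstoD(1)[OF G]) simp
  ultimately have "\<forall>\<^sub>F n in sequentially. max_weight_box x n / real n ^ CARD('d) / c
      \<le> real (min_size_box x n) / real n ^ CARD('d)"
    using eventually_ge_at_top[of 1]
  proof eventually_elim
    case (elim n)
    define V where "V = real n ^ CARD('d)"
    have "V > 0" using elim(3) by (simp add: V_def)
    have "real n \<le> V" using elim(3) by (simp add: V_def self_le_power)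
    with elim(1) have "real k / \<delta> \<le> V" by linarith
    then have "real k \<le> \<delta> * V"
      using \<open>\<delta> > 0\<close> by (simp add: divide_le_eq mult.commute)
    obtain \<xi> where \<xi>: "lattice_animal \<xi>" "\<xi> \<subseteq> lattice_box n"
        "weight x \<xi> = max_weight_box x n" "card \<xi> = min_size_box x n"
      using obtain_optimal_animal[OF elim(3)] .
    have "weight x \<xi> \<le> c * real (card \<xi>)"
    proof (rule ccontr)
      assume "\<not> weight x \<xi> \<le> c * real (card \<xi>)"
      then have heavy: "c * real (card \<xi>) < weight x \<xi>" by simp
      have small: "real (card \<xi>) \<le> \<delta> * V"
      proof (cases "k \<le> card \<xi>")
        case True
        then have "\<xi> \<subseteq> {v \<in> lattice_box n. translate v x \<in> overweight c k}"
          using translate_in_overweight[OF \<xi>(1) _ _ heavy] \<xi>(2) by blast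
        then have "card \<xi> \<le> card {v \<in> lattice_box n. translate v x \<in> overweight c k}"
          by (intro card_mono) simp_all
        with k[OF elim(3)] show ?thesis by (simp add: V_def)
      qed (use \<open>real k \<le> \<delta> * V\<close> in simp)
      have "weight x \<xi> \<le> real K * real (card \<xi>) + G / 4 * V"
        using weight_le_truncated[OF finite_lattice_box \<xi>(2), of "real K" x] K[OF elim(3)]
        by (simp add: V_def)
      also have "real K * real (card \<xi>) \<le> (real K + 1) * (\<delta> * V)"
        using small by (intro mult_mono) auto
      also have "\<dots> = G / 4 * V" by (simp add: \<delta>_def field_simps)
      finally have "weight x \<xi> \<le> G / 2 * V" by simp
      with elim(2) \<open>V > 0\<close> show False by (simp add: \<xi>(3) V_def less_divide_eq)
    qed
    with \<open>V > 0\<close> \<open>c > 0\<close> show ?case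
      by (simp add: \<xi>(3,4) V_def divide_simps mult_ac)
  qed
  then have "liminf (\<lambda>n. ereal (max_weight_box x n / real n ^ CARD('d) / c))
      \<le> lower_size_density x"
    unfolding lower_size_density_def by (intro Liminf_mono) simp
  moreover have "(\<lambda>n. ereal (max_weight_box x n / real n ^ CARD('d) / c)) \<longlonglongrightarrow> ereal (G / c)"
    using G \<open>c > 0\<close> by (intro tendsto_intros) auto
  ultimately show ?thesis
    by (metis lim_imp_Liminf sequentially_bot)
qed

lemma lower_size_density_nonneg: "0 \<le> lower_size_density x"
  unfolding lower_size_density_def by (intro Liminf_bounded always_eventually) simp

lemma lower_size_density_mult_ge:
  fixes x :: "int ^ 'd \<Rightarrow> real"
  assumes "N > 0"
    and G: "(\<lambda>n. max_weight_box x n / real n ^ CARD('d)) \<longlonglongrightarrow> G"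
    and sparse: "\<And>j \<delta>. \<delta> > 0 \<Longrightarrow> \<exists>k. \<forall>n\<ge>1.
      real (card {v \<in> lattice_box n. translate v x \<in> overweight (N + 1 / real (Suc j)) k})
        \<le> \<delta> * real n ^ CARD('d)"
    and tails: "\<And>\<delta>. \<delta> > 0 \<Longrightarrow> \<exists>K. \<forall>n\<ge>1.
      (\<Sum>v\<in>lattice_box n. if real K < x v then x v else 0) \<le> \<delta> * real n ^ CARD('d)"
  shows "ereal G \<le> lower_size_density x * ereal N"
proof (cases "G > 0")
  case True
  have "N + 1 / real (Suc j) > 0" for j using \<open>N > 0\<close> by (simp add: add_pos_pos)
  then have "ereal (G / (N + 1 / real (Suc j))) \<le> lower_size_density x" for j
    using True by (intro lower_size_density_ge[OF _ _ G sparse tails])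
  moreover have "(\<lambda>j. ereal (G / (N + 1 / real (Suc j)))) \<longlonglongrightarrow> ereal (G / (N + 0))"
    using \<open>N > 0\<close> by (intro tendsto_intros LIMSEQ_inverse_real_of_nat[unfolded inverse_eq_divide]) auto
  ultimately have "ereal (G / (N + 0)) \<le> lower_size_density x"
    by (intro LIMSEQ_le_const2) blast+
  then have "ereal (G / N) * ereal N \<le> lower_size_density x * ereal N"
    using \<open>N > 0\<close> by (intro ereal_mult_right_mono) auto
  then show ?thesis using \<open>N > 0\<close> by simp
next
  case False
  then have "ereal G \<le> 0" by simp
  also have "0 \<le> lower_size_density x * ereal N"
    using lower_size_density_nonneg[of x] \<open>N > 0\<close> by simp
  finally show ?thesis .
qed

section \<open>Integrability of the positive part\<close>

lemma nn_integral_eq_integral_tail: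
  fixes \<mu> :: "real measure"
  assumes "real_distribution \<mu>"
  shows "(\<integral>\<^sup>+y. ennreal y \<partial>\<mu>) = (\<integral>\<^sup>+t\<in>{0..}. ennreal (1 - cdf \<mu> t) \<partial>lborel)"
proof -
  interpret real_distribution \<mu> by fact
  interpret pair_sigma_finite lborel \<mu> ..
  define D where "D = {p \<in> space (lborel \<Otimes>\<^sub>M \<mu>). 0 \<le> fst p \<and> fst p < snd p}"
  have [measurable]: "D \<in> sets (lborel \<Otimes>\<^sub>M \<mu>)"
    unfolding D_def by measurable
  have "(\<integral>\<^sup>+y. ennreal y \<partial>\<mu>) = (\<integral>\<^sup>+y. (\<integral>\<^sup>+t. indicator D (t, y) \<partial>lborel) \<partial>\<mu>)"
  proof (rule nn_integral_cong)
    fix y :: real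
    have "(\<integral>\<^sup>+t. indicator D (t, y) \<partial>lborel) = (\<integral>\<^sup>+t. indicator {0..<y} t \<partial>lborel)"
      by (rule nn_integral_cong) (simp add: D_def indicator_def space_pair_measure)
    also have "\<dots> = ennreal y"
      by (cases "0 \<le> y") (simp_all add: ennreal_neg)
    finally show "ennreal y = (\<integral>\<^sup>+t. indicator D (t, y) \<partial>lborel)" ..
  qed
  also have "\<dots> = (\<integral>\<^sup>+t. (\<integral>\<^sup>+y. indicator D (t, y) \<partial>\<mu>) \<partial>lborel)"
    by (rule Fubini') simp
  also have "\<dots> = (\<integral>\<^sup>+t\<in>{0..}. ennreal (1 - cdf \<mu> t) \<partial>lborel)"
  proof (rule nn_integral_cong)
    fix t :: real
    have "(\<integral>\<^sup>+y. indicator D (t, y) \<partial>\<mu>) = (\<integral>\<^sup>+y. indicator {t<..} y * indicator {0..} t \<partial>\<mu>)"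
      by (rule nn_integral_cong) (auto simp: D_def indicator_def space_pair_measure)
    also have "\<dots> = emeasure \<mu> {t<..} * indicator {0..} t"
      by (simp add: nn_integral_multc)
    also have "emeasure \<mu> {t<..} = ennreal (1 - cdf \<mu> t)"
      using prob_compl[of "{..t}"]
      by (simp add: emeasure_eq_measure cdf_def Compl_eq_Diff_UNIV[symmetric] flip: not_le)
    finally show "(\<integral>\<^sup>+y. indicator D (t, y) \<partial>\<mu>) = ennreal (1 - cdf \<mu> t) * indicator {0..} t" .
  qed
  finally show ?thesis .
qed

text \<open>A number in \<open>[0, 1]\<close> is at most its \<open>p\<close>-th power for \<open>p \<le> 1\<close>, so the tail itself is integrable.\<close>

lemma nn_integral_finite_of_root_tail:
  fixes \<mu> :: "real measure"
  assumes "real_distribution \<mu>" "0 < p" "p \<le> 1"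
    and "(\<integral>\<^sup>+t\<in>{0..}. ennreal ((1 - cdf \<mu> t) powr p) \<partial>lborel) < \<infinity>"
  shows "(\<integral>\<^sup>+y. ennreal y \<partial>\<mu>) < \<infinity>"
proof -
  interpret real_distribution \<mu> by fact
  have "1 - cdf \<mu> t \<le> (1 - cdf \<mu> t) powr p" for t
    using powr_mono'[of p 1 "1 - cdf \<mu> t"] assms(2,3) cdf_bounded_prob[of t] cdf_nonneg[of t]
    by simp
  then have "(\<integral>\<^sup>+t\<in>{0..}. ennreal (1 - cdf \<mu> t) \<partial>lborel)
      \<le> (\<integral>\<^sup>+t\<in>{0..}. ennreal ((1 - cdf \<mu> t) powr p) \<partial>lborel)"
    by (intro nn_integral_mono mult_right_mono ennreal_leI) auto
  with assms(4) show ?thesis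
    by (simp add: nn_integral_eq_integral_tail[OF assms(1)] order.strict_trans1)
qed

section \<open>The space of configurations\<close>

lemma overweight_measurable:
  fixes \<mu> :: "real measure"
  assumes [measurable_cong]: "sets \<mu> = sets borel"
  shows "overweight c k \<in> sets (PiM (UNIV :: (int ^ 'd) set) (\<lambda>_. \<mu>))"
proof -
  let ?P = "PiM (UNIV :: (int ^ 'd) set) (\<lambda>_. \<mu>)"
  let ?A = "{\<xi> :: (int ^ 'd) set. finite \<xi> \<and> lattice_animal \<xi> \<and> 0 \<in> \<xi> \<and> k \<le> card \<xi>}"
  have "space ?P = UNIV"
    using sets_eq_imp_space_eq[OF assms] by (simp add: space_PiM)
  have "countable ?A"
    by (rule countable_subset[OF _ countable_Collect_finite]) auto
  moreover have "{x \<in> space ?P. c * real (card \<xi>) < weight x \<xi>} \<in> sets ?P" for \<xi>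
    unfolding weight_def by measurable
  moreover have "overweight c k = (\<Union>\<xi>\<in>?A. {x \<in> space ?P. c * real (card \<xi>) < weight x \<xi>})"
    using \<open>space ?P = UNIV\<close> by (auto simp: overweight_def lattice_animal_def)
  ultimately show ?thesis
    by (metis (no_types, lifting) sets.countable_UN'')
qed

lemma translate_action:
  fixes \<mu> :: "real measure"
  assumes "prob_space \<mu>" and [measurable_cong]: "sets \<mu> = sets borel"
  shows "measure_preserving_lattice_action (PiM (UNIV :: (int ^ 'd) set) (\<lambda>_. \<mu>)) translate"
proof
  let ?P = "PiM (UNIV :: (int ^ 'd) set) (\<lambda>_. \<mu>)"
  fix v :: "int ^ 'd"
  show "translate v \<in> ?P \<rightarrow>\<^sub>M ?P"
    using sets_eq_imp_space_eq[OF assms(2)] unfolding translate_def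
    by (intro measurable_PiM_single') (auto simp: space_PiM)
  show "distr ?P ?P (translate v) = ?P"
    using distr_PiM_reindex[of UNIV "\<lambda>_. \<mu>" "(+) v" UNIV] assms(1)
    by (simp add: translate_def[abs_def] restrict_UNIV)
next
  fix u v :: "int ^ 'd" and x
  show "translate v (translate u x) = translate (u + v) x"
    by (simp add: translate_def add.assoc)
qed

context
  fixes \<mu> :: "real measure" and P :: "(int ^ 'd \<Rightarrow> real) measure"
  assumes \<mu>: "prob_space \<mu>" "sets \<mu> = sets borel"
  defines "P \<equiv> PiM UNIV (\<lambda>_. \<mu>)"
begin

interpretation P: measure_preserving_lattice_action P translate
  unfolding P_def by (rule translate_action[OF \<mu>])

interpretation P: prob_space P
  unfolding P_def by (intro prob_space_PiM \<mu>)

text \<open>The indicators of \<open>overweight c k\<close> decrease to \<open>0\<close> almost everywhere as \<open>k\<close> grows, so their integrals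
  tend to \<open>0\<close>, and a sum of indicators over the box counts its exceptional sites.\<close>

lemma AE_overweight_sites_sparse:
  assumes "AE x in P. \<exists>k. x \<notin> overweight c k"
  shows "AE x in P. \<forall>\<delta>>0. \<exists>k. \<forall>n\<ge>1.
    real (card {v \<in> lattice_box n. translate v x \<in> overweight c k}) \<le> \<delta> * real n ^ CARD('d)"
proof -
  have [measurable]: "overweight c k \<in> sets P" for k
    unfolding P_def by (rule overweight_measurable[OF \<mu>(2)])
  have "(\<lambda>k. \<integral>\<^sup>+x. indicator (overweight c k) x \<partial>P) \<longlonglongrightarrow> (\<integral>\<^sup>+x. 0 \<partial>P)"
  proof (rule nn_integral_dominated_convergence[where w = "\<lambda>_. 1"])
    from assms show "AE x in P. (\<lambda>k. indicator (overweight c k) x :: ennreal) \<longlonglongrightarrow> 0"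
    proof eventually_elim
      case (elim x)
      then obtain k where "x \<notin> overweight c k" ..
      then have "\<forall>l\<ge>k. x \<notin> overweight c l" using overweight_antimono by blast
      then show ?case
        by (intro tendsto_eventually) (auto simp: eventually_sequentially indicator_def)
    qed
  qed (simp_all add: P.emeasure_space_1 indicator_def)
  then have "AE x in P. \<forall>\<delta>>0. \<exists>k. \<forall>n\<ge>1.
      (\<Sum>v\<in>lattice_box n. indicator (overweight c k) (translate v x))
        \<le> ennreal (\<delta> * real n ^ CARD('d))"
    by (intro P.AE_uniformly_small_averages) simp_all
  then show ?thesis
  proof (rule eventually_mono, intro allI impI)
    fix x :: "int ^ 'd \<Rightarrow> real" and \<delta> :: real
    assume "\<forall>\<delta>>0. \<exists>k. \<forall>n\<ge>1. (\<Sum>v\<in>lattice_box n. indicator (overweight c k) (translate v x))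
        \<le> ennreal (\<delta> * real n ^ CARD('d))" and "\<delta> > 0"
    then obtain k where k: "\<And>n. n \<ge> 1 \<Longrightarrow>
        (\<Sum>v\<in>lattice_box n. indicator (overweight c k) (translate v x))
          \<le> ennreal (\<delta> * real n ^ CARD('d))" by auto
    have count: "(\<Sum>v\<in>lattice_box n. indicator (overweight c k) (translate v x))
        = ennreal (real (card {v \<in> lattice_box n. translate v x \<in> overweight c k}))" for n
      by (simp add: indicator_def sum.If_cases Int_def ennreal_of_nat_eq_real_of_nat)
    have "real (card {v \<in> lattice_box n. translate v x \<in> overweight c k})
        \<le> \<delta> * real n ^ CARD('d)" if "n \<ge> 1" for n
      using k[OF that, unfolded count] \<open>\<delta> > 0\<close> by (simp add: ennreal_le_iff)
    then show "\<exists>k. \<forall>n\<ge>1.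
        real (card {v \<in> lattice_box n. translate v x \<in> overweight c k}) \<le> \<delta> * real n ^ CARD('d)"
      by blast
  qed
qed

lemma AE_truncated_sums_small:
  assumes "(\<integral>\<^sup>+y. ennreal y \<partial>\<mu>) < \<infinity>"
  shows "AE x in P. \<forall>\<delta>>0. \<exists>K. \<forall>n\<ge>1.
    (\<Sum>v\<in>lattice_box n. if real K < x v then x v else 0) \<le> \<delta> * real n ^ CARD('d)"
proof -
  define \<phi> where "\<phi> K x = ennreal (if real K < x 0 then x 0 else 0)"
    for K :: nat and x :: "int ^ 'd \<Rightarrow> real"
  have coord: "(\<lambda>x. x 0) \<in> P \<rightarrow>\<^sub>M \<mu>"
    unfolding P_def by simp
  then have [measurable]: "(\<lambda>x. x 0) \<in> P \<rightarrow>\<^sub>M borel"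
    by (simp add: measurable_cong_sets[OF refl \<mu>(2)])
  have [measurable]: "\<phi> K \<in> borel_measurable P" for K
    unfolding \<phi>_def by measurable
  have "(\<lambda>K. \<integral>\<^sup>+x. \<phi> K x \<partial>P) \<longlonglongrightarrow> (\<integral>\<^sup>+x. 0 \<partial>P)"
  proof (rule nn_integral_dominated_convergence[where w = "\<lambda>x. ennreal (x 0)"])
    have "distr P \<mu> (\<lambda>x. x 0) = \<mu>"
      unfolding P_def by (rule distr_PiM_component) (simp_all add: \<mu>(1))
    then have "(\<integral>\<^sup>+x. ennreal (x 0) \<partial>P) = (\<integral>\<^sup>+y. ennreal y \<partial>\<mu>)"
      using nn_integral_distr[OF coord, of ennreal]
      by (simp add: measurable_cong_sets[OF \<mu>(2) refl])
    with assms show "(\<integral>\<^sup>+x. ennreal (x 0) \<partial>P) < \<infinity>" by simp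
    show "AE x in P. (\<lambda>K. \<phi> K x) \<longlonglongrightarrow> 0"
    proof (rule AE_I2)
      fix x :: "int ^ 'd \<Rightarrow> real"
      obtain k :: nat where "x 0 \<le> real k" using real_arch_simple by blast
      then show "(\<lambda>K. \<phi> K x) \<longlonglongrightarrow> 0"
        by (intro tendsto_eventually) (auto simp: eventually_sequentially \<phi>_def intro!: exI[of _ k])
    qed
    show "AE x in P. \<phi> K x \<le> ennreal (x 0)" for K
      by (rule AE_I2) (auto simp: \<phi>_def)
  qed simp_all
  then have "AE x in P. \<forall>\<delta>>0. \<exists>K. \<forall>n\<ge>1.
      (\<Sum>v\<in>lattice_box n. \<phi> K (translate v x)) \<le> ennreal (\<delta> * real n ^ CARD('d))"
    by (intro P.AE_uniformly_small_averages) simp_all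
  moreover have "(\<Sum>v\<in>lattice_box n. \<phi> K (translate v x))
      = ennreal (\<Sum>v\<in>lattice_box n. if real K < x v then x v else 0)" for n K x
    unfolding \<phi>_def translate_def add_0_right
    by (subst sum_ennreal) (auto intro: order_trans less_imp_le)
  ultimately show ?thesis
    by (auto elim!: eventually_mono simp: ennreal_le_iff)
qed

end

text \<open>Independence and the common distribution function determine the law of the whole field; this
  identifies it with the product measure, on which translations act.\<close>

lemma distr_field_eq_PiM:
  fixes X :: "int ^ 'd \<Rightarrow> 'a \<Rightarrow> real"
  assumes "prob_space M" "prob_space.indep_vars M (\<lambda>_. borel) X UNIV"
    and "\<And>v. cdf (distr M borel (X v)) = F"
  defines "\<mu> \<equiv> distr M borel (X 0)"
  shows "distr M (PiM UNIV (\<lambda>_. \<mu>)) (\<lambda>\<omega> v. X v \<omega>) = PiM UNIV (\<lambda>_. \<mu>)"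
proof -
  interpret prob_space M by fact
  have X: "X v \<in> borel_measurable M" for v
    using assms(2) by (simp add: indep_vars_def)
  have "real_distribution (distr M borel (X v))" for v
    by (rule real_distribution_distr) (rule X)
  then have "distr M borel (X v) = \<mu>" for v
    using assms(3) by (simp add: \<mu>_def cdf_unique)
  then have "distr M (PiM UNIV (\<lambda>_. borel)) (\<lambda>\<omega> v. X v \<omega>) = PiM UNIV (\<lambda>_. \<mu>)"
    using assms(2) indep_vars_iff_distr_eq_PiM[where I = UNIV and X = X and M' = "\<lambda>_. borel"] X
    by (simp add: restrict_UNIV)
  moreover have "sets (PiM UNIV (\<lambda>_. borel)) = sets (PiM (UNIV :: (int ^ 'd) set) (\<lambda>_. \<mu>))"
    by (intro sets_PiM_cong) (simp_all add: \<mu>_def)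
  ultimately show ?thesis
    by (metis distr_cong)
qed

section \<open>The inequality\<close>

theorem theorem1p3:
  fixes M :: "'a measure"
    and X :: "int ^ 'd \<Rightarrow> 'a \<Rightarrow> real"
    and F :: "real \<Rightarrow> real"
    and N G :: real
  assumes "CARD('d) \<ge> 2"
    and "prob_space M"
    and "prob_space.indep_vars M (\<lambda>_. borel) X UNIV"
    and "\<And>v. cdf (distr M borel (X v)) = F"
    and "(\<integral>\<^sup>+x\<in>{0..}. ennreal ((1 - F x) powr (1 / real CARD('d))) \<partial>lborel) < \<infinity>"
    and "AE \<omega> in M. (\<lambda>n. max_weight_origin (\<lambda>v. X v \<omega>) n / real n) \<longlonglongrightarrow> N"
    and "AE \<omega> in M. (\<lambda>n. max_weight_box (\<lambda>v. X v \<omega>) n / real n ^ CARD('d)) \<longlonglongrightarrow> G"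
    and "N > 0"
  shows "AE \<omega> in M. ereal G \<le> lower_size_density (\<lambda>v. X v \<omega>) * ereal N"
proof -
  interpret prob_space M by fact
  define \<mu> where "\<mu> = distr M borel (X 0)"
  define P where "P = PiM (UNIV :: (int ^ 'd) set) (\<lambda>_. \<mu>)"
  define Y where "Y = (\<lambda>\<omega> v. X v \<omega>)"
  have X [measurable]: "X v \<in> borel_measurable M" for v
    using assms(3) by (simp add: indep_vars_def)
  have sets_\<mu> [measurable_cong]: "sets \<mu> = sets borel" by (simp add: \<mu>_def)
  have \<mu>: "real_distribution \<mu>"
    unfolding \<mu>_def by (rule real_distribution_distr) (rule X)
  then have prob_\<mu>: "prob_space \<mu>" by (simp add: real_distribution_def)
  have Y [measurable]: "Y \<in> M \<rightarrow>\<^sub>M P"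
    using sets_eq_imp_space_eq[OF sets_\<mu>] unfolding Y_def P_def
    by (intro measurable_PiM_single') auto
  have distr_Y: "distr M P Y = P"
    unfolding P_def Y_def \<mu>_def by (rule distr_field_eq_PiM[OF assms(2-4)])
  have pull_back: "AE \<omega> in M. Q (Y \<omega>)" if "AE x in P. Q x" for Q
    by (rule AE_distrD[OF Y]) (simp only: distr_Y that)

  (* The convergence at the origin holds under M. Only its consequence for the measurable
     sets overweight c k is carried over to P, where the maximal inequality is available. *)
  have "AE x in P. \<exists>k. x \<notin> overweight (N + 1 / real (Suc j)) k" for j
  proof -
    let ?c = "N + 1 / real (Suc j)"
    have [measurable]: "overweight ?c k \<in> sets P" for k
      unfolding P_def by (rule overweight_measurable[OF sets_\<mu>])
    have "AE \<omega> in M. \<exists>k. Y \<omega> \<notin> overweight ?c k"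
      using assms(6) by eventually_elim (auto simp: Y_def intro: eventually_not_overweight)
    then have "AE x in distr M P Y. \<exists>k. x \<notin> overweight ?c k"
      by (subst AE_distr_iff[OF Y]) measurable
    then show ?thesis by (simp only: distr_Y)
  qed
  then have "AE x in P. \<forall>\<delta>>0. \<exists>k. \<forall>n\<ge>1.
      real (card {v \<in> lattice_box n. translate v x \<in> overweight (N + 1 / real (Suc j)) k})
        \<le> \<delta> * real n ^ CARD('d)" for j
    unfolding P_def by (intro AE_overweight_sites_sparse[OF prob_\<mu> sets_\<mu>])
  then have sparse: "AE \<omega> in M. \<forall>j. \<forall>\<delta>>0. \<exists>k. \<forall>n\<ge>1.
      real (card {v \<in> lattice_box n. translate v (Y \<omega>) \<in> overweight (N + 1 / real (Suc j)) k})
        \<le> \<delta> * real n ^ CARD('d)"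
    unfolding AE_all_countable by (intro allI pull_back)

  have "cdf \<mu> = F" unfolding \<mu>_def by (rule assms(4))
  then have "(\<integral>\<^sup>+y. ennreal y \<partial>\<mu>) < \<infinity>"
    using assms(5) by (intro nn_integral_finite_of_root_tail[OF \<mu>, of "1 / real CARD('d)"]) auto
  then have "AE x in P. \<forall>\<delta>>0. \<exists>K. \<forall>n\<ge>1.
      (\<Sum>v\<in>lattice_box n. if real K < x v then x v else 0) \<le> \<delta> * real n ^ CARD('d)"
    unfolding P_def by (rule AE_truncated_sums_small[OF prob_\<mu> sets_\<mu>])
  then have tails: "AE \<omega> in M. \<forall>\<delta>>0. \<exists>K. \<forall>n\<ge>1.
      (\<Sum>v\<in>lattice_box n. if real K < Y \<omega> v then Y \<omega> v else 0) \<le> \<delta> * real n ^ CARD('d)"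
    by (rule pull_back)

  show ?thesis
    using sparse tails assms(7) unfolding Y_def
  proof eventually_elim
    case (elim \<omega>)
    then show ?case
      by (intro lower_size_density_mult_ge[OF assms(8)]) blast+
  qed
qed

end
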